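(* Assume that $\xi$ is balanced with respect to $\lambda$, with associated one-species function $\xi_\star$. Let $f(t,q)=\lim_{N\to\infty}\bar F_N(t,q)$ be the limit free energy, or equivalently $$f(t,q)=\sup_{p\in\mathcal Q_\infty^{\mathscr S}}\inf_{q'\in\mathcal Q_\infty^{\mathscr S}}\Big\{\psi(q')+\langle q-q',p\rangle_{L^2}+t\int_0^1\xi(p(v))\,\mathrm dv\Big\},$$ and let $$u(t,r)=\sup_{a\in\mathcal Q_\infty}\inf_{r'\in\mathcal Q_\infty}\Big\{\psi_\circ(r')+\langle r-r',a\rangle_{L^2}+t\int_0^1\xi_\star(a(v))\,\mathrm dv\Big\},\qquad(t,r)\in\mathbb R_+\times\mathcal Q_2 .$$ Then, for every $t\ge0$ and every $q=(q_s)_{s\in\mathscr S}\in\mathcal Q_2^{\mathscr S}$, $$u\Big(t,\sum_{s\in\mathscr S}\lambda_sq_s\Big)\le f(t,q)\le\sum_{s\in\mathscr S}\lambda_s\,u(t,q_s).$$ In particular, $f(t,0)=u(t,0)$ for every $t\ge0$.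
   Context: **Model.** $\mathscr S$ is a finite set (species). For each $N\in\mathbb N$, $(I_{N,s})_{s\in\mathscr S}$ is a partition of $\{1,\dots,N\}$; $\lambda_{N,s}=|I_{N,s}|/N$, $\lambda_N=(\lambda_{N,s})_s$, and $\lambda_N\to\lambda=(\lambda_s)_{s\in\mathscr S}\in(0,1)^{\mathscr S}$ (so $\sum_s\lambda_s=1$). For $\sigma,\sigma'\in\{-1,1\}^N$, $R_{N,s}(\sigma,\sigma')=\frac1N\sum_{n\in I_{N,s}}\sigma_n\sigma'_n$ and $R_N=(R_{N,s})_s$. The function $\xi:\mathbb R^{\mathscr S}\to\mathbb R$ admits an absolutely convergent power-series expansion, and for every $N$, $(H_N(\sigma))_{\sigma\in\{-1,1\}^N}$ is a centered Gaussian field with covariance $N\xi(R_N(\sigma,\sigma'))$. No convexity of $\xi$ is assumed. **Balanced.** $\xi$ is balanced with respect to $\lambda$ if there exists a (one-species covariance) function $\xi_\star:\mathbb R_+\to\mathbb R$ such that $\xi(r\lambda)=\xi_\star(r)$ for every $r\in\mathbb R_+$, where $r\lambda=(r\lambda_s)_s$, and $\xi(a)\le\sum_{s\in\mathscr S}\lambda_s\xi_\star(a_s/\lambda_s)$ for every $a\in\mathbb R_+^{\mathscr S}$. **Paths.** $\mathcal Q$ is the set of right-continuous nondecreasing paths $q:[0,1)\to\mathbb R_+$; $\mathcal Q_p=\mathcal Q\cap L^p[0,1)$. For $q\in\mathcal Q_\infty$, $q(1)=\lim_{r\nearrow1}q(r)$. $\langle\cdot,\cdot\rangle_{L^2}$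 is the $L^2([0,1))$ inner product (of $\mathbb R$- or $\mathbb R^{\mathscr S}$-valued functions). **Cascade.** $\mathfrak R$ is a Poisson–Dirichlet (Ruelle) probability cascade with overlap uniformly distributed over $[0,1]$: a random probability measure on the unit sphere of a separable Hilbert space with inner product denoted $\wedge$, such that for i.i.d. samples $(\alpha^\ell)_{\ell\ge1}$ from $\mathfrak R$, $\alpha^1\wedge\alpha^2$ is uniform on $[0,1]$ (under the average over samples and $\mathfrak R$) and the array $(\alpha^\ell\wedge\alpha^{\ell'})$ satisfies the Ghirlanda–Guerra identities. **Enriched free energy.** For $q\in\mathcal Q_\infty^{\mathscr S}$, conditionally on $\mathfrak R$, let $(w_n^{q_s}(\alpha))_\alpha$, $s\in\mathscr S$, $n\in I_{N,s}$, be independent centered Gaussian processes with covariance $q_s(\alpha\wedge\alpha')$, independent of $H_N$, and $W_N^q(\sigma,\alpha)=\sum_s\sum_{n\in I_{N,s}}w_n^{q_s}(\alpha)\sigma_n$. Then $$\bar F_N(t,q)=-\frac1N\mathbb E\log\sum_{\sigma\in\{-1,1\}^N}\int2^{-N}\exp\Big(\sqrt{2t}H_N(\sigma)-tN\xi(\lambda_N)+\sqrt2W_N^q(\sigma,\alpha)-N\sum_s\lambda_{N,s}q_s(1)\Big)\mathrm d\mathfrak R(\alpha),$$ extended by $L^1$-continuity to $q\in\mathcal Q_1^{\mathscr S}$. For every $t\geq 0$ and $q\in\mathcal Q_2^{\mathscr S}$ the limit of $\bar F_N(t,q)$ exists and equals the $\sup\inf$ formula for $f$ displayed in the claim. **$\psi$.**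 For $r\in\mathcal Q_\infty$, $\psi_\circ(r)=-\mathbb E\log\int\cosh(\sqrt2w^r(\alpha))\,\mathrm d\mathfrak R(\alpha)+r(1)$, where given $\mathfrak R$, $w^r$ is a centered Gaussian process with covariance $r(\alpha\wedge\alpha')$; $\psi_\circ$ is extended by $L^1$-continuity to $\mathcal Q_1$. $\psi(q)=\sum_{s}\lambda_s\psi_\circ(q_s)$. *)

theory Defs
  imports "HOL-Probability.Probability"
begin

section \<open>Paths\<close>

text \<open>A path on \<open>[0,1)\<close> is a function on the reals of which only the values on \<open>{0..<1}\<close>
  are ever used. A species-indexed path is a function \<open>'s \<Rightarrow> real \<Rightarrow> real\<close>.\<close>

definition paths :: "(real \<Rightarrow> real) set" where
  "paths = {q. (\<forall>v\<in>{0..<1}. 0 \<le> q v) \<and> mono_on {0..<1} q \<and>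
               (\<forall>v\<in>{0..<1}. continuous (at_right v) q)}"

definition paths_Lp :: "nat \<Rightarrow> (real \<Rightarrow> real) set" where
  "paths_Lp p = {q \<in> paths. set_integrable lborel {0..<1} (\<lambda>v. \<bar>q v\<bar> ^ p)}"

definition paths_Linf :: "(real \<Rightarrow> real) set" where
  "paths_Linf = {q \<in> paths. \<exists>C. AE v\<in>{0..<1} in lborel. \<bar>q v\<bar> \<le> C}"

definition path_at :: "(real \<Rightarrow> real) \<Rightarrow> real \<Rightarrow> real" where
  "path_at q v = (if v < 1 then q v else Lim (at_left 1) q)"

definition inner_L2 :: "(real \<Rightarrow> real) \<Rightarrow> (real \<Rightarrow> real) \<Rightarrow> real" where
  "inner_L2 g h = (LINT v:{0..<1}|lborel. g v * h v)"

definition L1_tendsto :: "(nat \<Rightarrow> 's \<Rightarrow> real \<Rightarrow> real) \<Rightarrow> ('s \<Rightarrow> real \<Rightarrow> real) \<Rightarrow> bool" where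
  "L1_tendsto Q q \<longleftrightarrow>
     (\<forall>s. (\<lambda>k. LINT v:{0..<1}|lborel. \<bar>Q k s v - q s v\<bar>) \<longlonglongrightarrow> 0)"

definition L1_extension ::
    "(('s \<Rightarrow> real \<Rightarrow> real) \<Rightarrow> real) \<Rightarrow> ('s \<Rightarrow> real \<Rightarrow> real) \<Rightarrow> real" where
  "L1_extension \<Phi> q =
     (THE y. \<forall>Q. (\<forall>k. Q k \<in> UNIV \<rightarrow> paths_Linf) \<and> L1_tendsto Q q \<longrightarrow> (\<lambda>k. \<Phi> (Q k)) \<longlonglongrightarrow> y)"


section \<open>Gaussian families\<close>

text \<open>Degenerate (Dirac) laws count as Gaussian.\<close>

definition gaussian_rv :: "'w measure \<Rightarrow> ('w \<Rightarrow> real) \<Rightarrow> bool" where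
  "gaussian_rv M X \<longleftrightarrow> X \<in> borel_measurable M \<and>
     (\<exists>\<mu> \<sigma>. 0 \<le> \<sigma> \<and>
        distr M borel X =
          (if \<sigma> = 0 then return borel \<mu> else density lborel (normal_density \<mu> \<sigma>)))"

definition centered_gaussian_process ::
    "'w measure \<Rightarrow> 'i set \<Rightarrow> ('i \<Rightarrow> 'w \<Rightarrow> real) \<Rightarrow> ('i \<Rightarrow> 'i \<Rightarrow> real) \<Rightarrow> bool" where
  "centered_gaussian_process M A X C \<longleftrightarrow>
     (\<forall>J c. finite J \<and> J \<subseteq> A \<longrightarrow> gaussian_rv M (\<lambda>x. \<Sum>i\<in>J. c i * X i x)) \<and>
     (\<forall>i\<in>A. (\<integral>x. X i x \<partial>M) = 0) \<and>
     (\<forall>i\<in>A. \<forall>j\<in>A. (\<integral>x. X i x * X j x \<partial>M) = C i j)"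


section \<open>The Poisson--Dirichlet cascade\<close>

definition measure_support :: "'h::topological_space measure \<Rightarrow> 'h set" where
  "measure_support \<mu> = {x. \<forall>U. open U \<and> x \<in> U \<longrightarrow> 0 < emeasure \<mu> U}"

text \<open>Average over the random measure \<open>R\<close> and over i.i.d. samples \<open>\<alpha> 1, \<dots>, \<alpha> n\<close> from it.\<close>

definition replica_mean ::
    "'o measure \<Rightarrow> ('o \<Rightarrow> 'h measure) \<Rightarrow> nat \<Rightarrow> ((nat \<Rightarrow> 'h) \<Rightarrow> real) \<Rightarrow> real" where
  "replica_mean P R n g = (\<integral>\<omega>. (\<integral>\<alpha>. g \<alpha> \<partial>(\<Pi>\<^sub>M l\<in>{1..n}. R \<omega>)) \<partial>P)"

definition overlap_array :: "nat \<Rightarrow> (nat \<Rightarrow> 'h::real_inner) \<Rightarrow> nat \<times> nat \<Rightarrow> real" where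
  "overlap_array n \<alpha> = restrict (\<lambda>(l, m). \<alpha> l \<bullet> \<alpha> m) ({1..n} \<times> {1..n})"

definition ghirlanda_guerra ::
    "'o measure \<Rightarrow> ('o \<Rightarrow> 'h::real_inner measure) \<Rightarrow> bool" where
  "ghirlanda_guerra P R \<longleftrightarrow>
     (\<forall>n\<ge>1. \<forall>g \<in> borel_measurable (\<Pi>\<^sub>M lm\<in>{1..n} \<times> {1..n}. (borel :: real measure)).
        \<forall>h \<in> borel_measurable (borel :: real measure).
        bounded (range g) \<and> bounded (range h) \<longrightarrow>
        replica_mean P R (n + 1) (\<lambda>\<alpha>. g (overlap_array n \<alpha>) * h (\<alpha> 1 \<bullet> \<alpha> (n + 1))) =
          1 / real n * (replica_mean P R n (\<lambda>\<alpha>. g (overlap_array n \<alpha>)) *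
                        replica_mean P R 2 (\<lambda>\<alpha>. h (\<alpha> 1 \<bullet> \<alpha> 2))) +
          1 / real n * (\<Sum>l = 2..n.
             replica_mean P R n (\<lambda>\<alpha>. g (overlap_array n \<alpha>) * h (\<alpha> 1 \<bullet> \<alpha> l))))"

locale poisson_dirichlet_cascade =
  fixes P :: "'o measure"
    and R :: "'o \<Rightarrow> 'h::{real_inner, complete_space, second_countable_topology} measure"
  assumes P_prob: "prob_space P"
    and R_random_measure: "R \<in> P \<rightarrow>\<^sub>M prob_algebra borel"
    and R_sphere: "AE \<omega> in P. emeasure (R \<omega>) (sphere 0 1) = 1"
    and overlap_uniform: "\<And>A. A \<in> sets borel \<Longrightarrow>
          replica_mean P R 2 (\<lambda>\<alpha>. indicator A (\<alpha> 1 \<bullet> \<alpha> 2)) = measure lborel (A \<inter> {0..1})"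
    and overlap_ghirlanda_guerra: "ghirlanda_guerra P R"

text \<open>Everything Gaussian lives on a second probability space \<open>G\<close>, and the randomness as a whole
  on the product of \<open>P\<close> and \<open>G\<close>: ``conditionally on the cascade'' means ``for almost every fixed
  \<open>\<omega>\<close>, as random variables on \<open>G\<close>''. The value \<open>w n r \<omega> \<alpha> x\<close> is \<open>w\<^sub>n\<^sup>r(\<alpha>)\<close> at the sample
  \<open>(\<omega>, x)\<close>. The covariance \<open>r(\<alpha> \<and> \<alpha>')\<close> is only meaningful, and only prescribed, for \<open>\<alpha>, \<alpha>'\<close> in
  the support of the cascade; joint measurability makes the integrals over \<open>\<alpha>\<close> random variables.\<close>

locale cascade_gaussian_processes = poisson_dirichlet_cascade P R
  for P :: "'o measure"
    and R :: "'o \<Rightarrow> 'h::{real_inner, complete_space, second_countable_topology} measure" +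
  fixes G :: "'w measure"
    and w :: "nat \<Rightarrow> (real \<Rightarrow> real) \<Rightarrow> 'o \<Rightarrow> 'h \<Rightarrow> 'w \<Rightarrow> real"
  assumes G_prob: "prob_space G"
    and w_measurable: "\<And>n r. r \<in> paths_Linf \<Longrightarrow>
          (\<lambda>(\<omega>, \<alpha>, x). w n r \<omega> \<alpha> x) \<in> borel_measurable (P \<Otimes>\<^sub>M (borel \<Otimes>\<^sub>M G))"
    and w_gaussian: "\<And>n r. r \<in> paths_Linf \<Longrightarrow>
          AE \<omega> in P. centered_gaussian_process G (measure_support (R \<omega>)) (w n r \<omega>)
                       (\<lambda>\<alpha> \<alpha>'. path_at r (\<alpha> \<bullet> \<alpha>'))"


section \<open>The multi-species model\<close>

definition spin_configs :: "nat \<Rightarrow> (nat \<Rightarrow> real) set" where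
  "spin_configs N = {1..N} \<rightarrow>\<^sub>E {-1, 1}"

definition species_fraction :: "(nat \<Rightarrow> 's::finite \<Rightarrow> nat set) \<Rightarrow> nat \<Rightarrow> real ^ 's" where
  "species_fraction I N = (\<chi> s. real (card (I N s)) / real N)"

definition species_overlap ::
    "(nat \<Rightarrow> 's::finite \<Rightarrow> nat set) \<Rightarrow> nat \<Rightarrow> (nat \<Rightarrow> real) \<Rightarrow> (nat \<Rightarrow> real) \<Rightarrow> real ^ 's" where
  "species_overlap I N \<sigma> \<tau> = (\<chi> s. (1 / real N) * (\<Sum>n\<in>I N s. \<sigma> n * \<tau> n))"

definition abs_convergent_power_series :: "(real ^ 's::finite \<Rightarrow> real) \<Rightarrow> bool" where
  "abs_convergent_power_series \<xi> \<longleftrightarrow>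
     (\<exists>c :: ('s \<Rightarrow> nat) \<Rightarrow> real. \<forall>x.
        (\<lambda>k. \<bar>c k * (\<Prod>s\<in>UNIV. (x $ s) ^ k s)\<bar>) summable_on UNIV \<and>
        \<xi> x = (\<Sum>\<^sub>\<infinity>k. c k * (\<Prod>s\<in>UNIV. (x $ s) ^ k s)))"

definition balanced ::
    "(real ^ 's::finite \<Rightarrow> real) \<Rightarrow> real ^ 's \<Rightarrow> (real \<Rightarrow> real) \<Rightarrow> bool" where
  "balanced \<xi> lam \<xi>\<^sub>1 \<longleftrightarrow>
     (\<forall>r\<ge>0. \<xi> (r *\<^sub>R lam) = \<xi>\<^sub>1 r) \<and>
     (\<forall>a. (\<forall>s. 0 \<le> a $ s) \<longrightarrow> \<xi> a \<le> (\<Sum>s\<in>UNIV. lam $ s * \<xi>\<^sub>1 (a $ s / lam $ s)))"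

locale multi_species_model = cascade_gaussian_processes P R G w
  for P :: "'o measure"
    and R :: "'o \<Rightarrow> 'h::{real_inner, complete_space, second_countable_topology} measure"
    and G :: "'w measure"
    and w :: "nat \<Rightarrow> (real \<Rightarrow> real) \<Rightarrow> 'o \<Rightarrow> 'h \<Rightarrow> 'w \<Rightarrow> real" +
  fixes I :: "nat \<Rightarrow> 's::finite \<Rightarrow> nat set"
    and lam :: "real ^ 's"
    and \<xi> :: "real ^ 's \<Rightarrow> real"
    and H :: "nat \<Rightarrow> (nat \<Rightarrow> real) \<Rightarrow> 'w \<Rightarrow> real"
  assumes species_disjoint: "\<And>N. N \<ge> 1 \<Longrightarrow> disjoint_family (I N)"
    and species_cover: "\<And>N. N \<ge> 1 \<Longrightarrow> (\<Union>s. I N s) = {1..N}"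
    and species_limit: "species_fraction I \<longlonglongrightarrow> lam"
    and lam_range: "\<And>s. lam $ s \<in> {0<..<1}"
    and \<xi>_power_series: "abs_convergent_power_series \<xi>"
    and H_gaussian: "\<And>N. N \<ge> 1 \<Longrightarrow>
          centered_gaussian_process G (spin_configs N) (H N)
            (\<lambda>\<sigma> \<tau>. real N * \<xi> (species_overlap I N \<sigma> \<tau>))"
    and w_indep: "\<And>N q. N \<ge> 1 \<Longrightarrow> q \<in> UNIV \<rightarrow> paths_Linf \<Longrightarrow>
          AE \<omega> in P. prob_space.indep_vars G
            (\<lambda>_. \<Pi>\<^sub>M \<alpha>\<in>measure_support (R \<omega>). borel)
            (\<lambda>(s, n) x. \<lambda>\<alpha>\<in>measure_support (R \<omega>). w n (q s) \<omega> \<alpha> x)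
            (SIGMA s:UNIV. I N s)"
    and H_w_indep: "\<And>N q. N \<ge> 1 \<Longrightarrow> q \<in> UNIV \<rightarrow> paths_Linf \<Longrightarrow>
          AE \<omega> in P. prob_space.indep_set G
            (sets (vimage_algebra (space G)
              (\<lambda>x. \<lambda>\<sigma>\<in>spin_configs N. H N \<sigma> x) (\<Pi>\<^sub>M \<sigma>\<in>spin_configs N. borel)))
            (sets (vimage_algebra (space G)
              (\<lambda>x. restrict (\<lambda>((s, n), \<alpha>). w n (q s) \<omega> \<alpha> x)
                     ((SIGMA s:UNIV. I N s) \<times> measure_support (R \<omega>)))
              (\<Pi>\<^sub>M i\<in>(SIGMA s:UNIV. I N s) \<times> measure_support (R \<omega>). borel)))"


section \<open>Free energies\<close>

definition external_field ::
    "(nat \<Rightarrow> (real \<Rightarrow> real) \<Rightarrow> 'o \<Rightarrow> 'h \<Rightarrow> 'w \<Rightarrow> real) \<Rightarrow> (nat \<Rightarrow> 's::finite \<Rightarrow> nat set) \<Rightarrow> nat \<Rightarrow>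
     ('s \<Rightarrow> real \<Rightarrow> real) \<Rightarrow> (nat \<Rightarrow> real) \<Rightarrow> 'o \<Rightarrow> 'h \<Rightarrow> 'w \<Rightarrow> real" where
  "external_field w I N q \<sigma> \<omega> \<alpha> x = (\<Sum>s\<in>UNIV. \<Sum>n\<in>I N s. w n (q s) \<omega> \<alpha> x * \<sigma> n)"

definition free_energy_bounded ::
    "'o measure \<Rightarrow> ('o \<Rightarrow> 'h measure) \<Rightarrow> 'w measure \<Rightarrow>
     (nat \<Rightarrow> (real \<Rightarrow> real) \<Rightarrow> 'o \<Rightarrow> 'h \<Rightarrow> 'w \<Rightarrow> real) \<Rightarrow> (nat \<Rightarrow> 's::finite \<Rightarrow> nat set) \<Rightarrow>
     (real ^ 's \<Rightarrow> real) \<Rightarrow> (nat \<Rightarrow> (nat \<Rightarrow> real) \<Rightarrow> 'w \<Rightarrow> real) \<Rightarrow>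
     nat \<Rightarrow> real \<Rightarrow> ('s \<Rightarrow> real \<Rightarrow> real) \<Rightarrow> real" where
  "free_energy_bounded P R G w I \<xi> H N t q =
     - (1 / real N) * (\<integral>\<omega>. (\<integral>x. ln (\<Sum>\<sigma>\<in>spin_configs N. \<integral>\<alpha>. (1 / 2 ^ N) * exp (
           sqrt (2 * t) * H N \<sigma> x - t * real N * \<xi> (species_fraction I N)
         + sqrt 2 * external_field w I N q \<sigma> \<omega> \<alpha> x
         - real N * (\<Sum>s\<in>UNIV. species_fraction I N $ s * path_at (q s) 1)) \<partial>R \<omega>) \<partial>G) \<partial>P)"

definition free_energy ::
    "'o measure \<Rightarrow> ('o \<Rightarrow> 'h measure) \<Rightarrow> 'w measure \<Rightarrow>
     (nat \<Rightarrow> (real \<Rightarrow> real) \<Rightarrow> 'o \<Rightarrow> 'h \<Rightarrow> 'w \<Rightarrow> real) \<Rightarrow> (nat \<Rightarrow> 's::finite \<Rightarrow> nat set) \<Rightarrow>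
     (real ^ 's \<Rightarrow> real) \<Rightarrow> (nat \<Rightarrow> (nat \<Rightarrow> real) \<Rightarrow> 'w \<Rightarrow> real) \<Rightarrow>
     nat \<Rightarrow> real \<Rightarrow> ('s \<Rightarrow> real \<Rightarrow> real) \<Rightarrow> real" where
  "free_energy P R G w I \<xi> H N t q = L1_extension (free_energy_bounded P R G w I \<xi> H N t) q"

text \<open>All processes \<open>w n r\<close>, for varying \<open>n\<close>, have the same law; the one with \<open>n = 0\<close> serves as \<open>w\<^sup>r\<close>.
  The formulas below evaluate this function on \<open>paths_Linf\<close> only, so its extension is not needed.\<close>

definition \<psi>_circ ::
    "'o measure \<Rightarrow> ('o \<Rightarrow> 'h measure) \<Rightarrow> 'w measure \<Rightarrow>
     (nat \<Rightarrow> (real \<Rightarrow> real) \<Rightarrow> 'o \<Rightarrow> 'h \<Rightarrow> 'w \<Rightarrow> real) \<Rightarrow> (real \<Rightarrow> real) \<Rightarrow> real" where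
  "\<psi>_circ P R G w r =
     - (\<integral>\<omega>. (\<integral>x. ln (\<integral>\<alpha>. cosh (sqrt 2 * w 0 r \<omega> \<alpha> x) \<partial>R \<omega>) \<partial>G) \<partial>P) + path_at r 1"

definition \<psi>_multi ::
    "'o measure \<Rightarrow> ('o \<Rightarrow> 'h measure) \<Rightarrow> 'w measure \<Rightarrow>
     (nat \<Rightarrow> (real \<Rightarrow> real) \<Rightarrow> 'o \<Rightarrow> 'h \<Rightarrow> 'w \<Rightarrow> real) \<Rightarrow> real ^ 's::finite \<Rightarrow>
     ('s \<Rightarrow> real \<Rightarrow> real) \<Rightarrow> real" where
  "\<psi>_multi P R G w lam q = (\<Sum>s\<in>UNIV. lam $ s * \<psi>_circ P R G w (q s))"

text \<open>The sup-inf formulas are taken in the extended reals, so that suprema and infima always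
  have their mathematical meaning.\<close>

definition multi_species_formula ::
    "'o measure \<Rightarrow> ('o \<Rightarrow> 'h measure) \<Rightarrow> 'w measure \<Rightarrow>
     (nat \<Rightarrow> (real \<Rightarrow> real) \<Rightarrow> 'o \<Rightarrow> 'h \<Rightarrow> 'w \<Rightarrow> real) \<Rightarrow> real ^ 's::finite \<Rightarrow>
     (real ^ 's \<Rightarrow> real) \<Rightarrow> real \<Rightarrow> ('s \<Rightarrow> real \<Rightarrow> real) \<Rightarrow> ereal" where
  "multi_species_formula P R G w lam \<xi> t q =
     (SUP p\<in>UNIV \<rightarrow> paths_Linf. INF q'\<in>UNIV \<rightarrow> paths_Linf.
        ereal (\<psi>_multi P R G w lam q' + (\<Sum>s\<in>UNIV. inner_L2 (\<lambda>v. q s v - q' s v) (p s))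
               + t * (LINT v:{0..<1}|lborel. \<xi> (\<chi> s. p s v))))"

definition one_species_formula ::
    "'o measure \<Rightarrow> ('o \<Rightarrow> 'h measure) \<Rightarrow> 'w measure \<Rightarrow>
     (nat \<Rightarrow> (real \<Rightarrow> real) \<Rightarrow> 'o \<Rightarrow> 'h \<Rightarrow> 'w \<Rightarrow> real) \<Rightarrow>
     (real \<Rightarrow> real) \<Rightarrow> real \<Rightarrow> (real \<Rightarrow> real) \<Rightarrow> ereal" where
  "one_species_formula P R G w \<xi>\<^sub>1 t r =
     (SUP a\<in>paths_Linf. INF r'\<in>paths_Linf.
        ereal (\<psi>_circ P R G w r' + inner_L2 (\<lambda>v. r v - r' v) a
               + t * (LINT v:{0..<1}|lborel. \<xi>\<^sub>1 (a v))))"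

end

theory Submission
  imports Defs
begin

text \<open>
  In the functional under the \<open>sup inf\<close>, the dual path \<open>q'\<close> enters only through a sum over species,
  and \<open>\<integral> \<xi>(p)\<close> does not involve \<open>q'\<close>. So for fixed \<open>p\<close> the infimum splits into one infimum per
  species, and the two halves of the balance condition say how \<open>\<xi>\<close> itself splits.

  For the upper bound, put \<open>a\<^sub>s = p\<^sub>s / \<lambda>\<^sub>s\<close>. By the inequality in the balance condition, the functional at
  \<open>(p, q')\<close> is at most the \<open>\<lambda>\<close>-average of the one-species functionals at \<open>(a\<^sub>s, q'\<^sub>s)\<close>
  (\<open>multi_functional_le_average\<close>). The infimum over \<open>q'\<close> of that average is at most the average of the infima
  (\<open>INF_weighted_sum_le\<close>), each of which is at most \<open>u(t, q\<^sub>s)\<close>.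

  For the lower bound, insert \<open>p = a \<lambda>\<close> for a single path \<open>a\<close>. The equality in the balance condition
  and \<open>\<Sum>\<^sub>s \<lambda>\<^sub>s = 1\<close> make the functional equal to the \<open>\<lambda>\<close>-average of one-species functionals,
  all with the same \<open>a\<close> and with the same path \<open>\<Sum>\<^sub>s \<lambda>\<^sub>s q\<^sub>s\<close>
  (\<open>multi_functional_on_ray\<close>), and an average of values of one functional is at least its infimum.

  At \<open>q = 0\<close> both bounds are \<open>u(t, 0)\<close>.
\<close>

section \<open>Integrability along paths\<close>

abbreviation unit_lborel :: "real measure" where
  "unit_lborel \<equiv> restrict_space lborel {0..<1}"

lemma finite_measure_unit_lborel: "finite_measure unit_lborel"
  by (rule finite_measureI) (simp add: emeasure_restrict_space space_restrict_space)

lemma set_integrable_unit_iff: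
  fixes g :: "real \<Rightarrow> real"
  shows "set_integrable lborel {0..<1} g \<longleftrightarrow> integrable unit_lborel g"
  by (rule set_integrable_eq) simp

lemma paths_measurable:
  assumes "q \<in> paths"
  shows "q \<in> borel_measurable unit_lborel"
proof -
  have "q \<in> borel_measurable (restrict_space borel {0..<1})"
    using assms by (intro borel_measurable_mono_on_fnc) (simp add: paths_def)
  then show ?thesis
    by (simp add: measurable_def sets_restrict_space space_restrict_space)
qed

text \<open>An almost-everywhere bound on a nondecreasing path is a bound everywhere, because the
  bound holds at some point to the right of any given one.\<close>

lemma paths_Linf_bounded:
  assumes "q \<in> paths_Linf"
  obtains C where "\<And>v. v \<in> {0..<1} \<Longrightarrow> \<bar>q v\<bar> \<le> C"
proof -
  have q: "q \<in> paths" and "\<exists>C. AE v\<in>{0..<1} in lborel. \<bar>q v\<bar> \<le> C"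
    using assms by (auto simp: paths_Linf_def)
  then obtain C where C: "AE v in lborel. v \<in> {0..<1} \<longrightarrow> \<bar>q v\<bar> \<le> C" by blast
  have "\<bar>q v\<bar> \<le> C" if v: "v \<in> {0..<1}" for v
  proof -
    have "\<exists>x\<in>{v<..<1}. \<bar>q x\<bar> \<le> C"
    proof (rule ccontr)
      assume "\<not> ?thesis"
      then have "AE x in lborel. x \<notin> {v<..<1}"
        using C v by (auto elim!: eventually_mono)
      then have "{v<..<1} \<in> null_sets lborel"
        by (subst (asm) AE_iff_null_sets[symmetric]) auto
      then have "emeasure lborel {v<..<1} = 0" by (rule null_setsD1)
      then show False using v by simp
    qed
    then obtain x where x: "x \<in> {v<..<1}" "\<bar>q x\<bar> \<le> C" by blast
    have "q v \<le> q x" "0 \<le> q v"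
      using q v x by (auto simp: paths_def intro: mono_onD)
    then show ?thesis using x(2) by linarith
  qed
  then show thesis by (rule that)
qed

lemma paths_cmult:
  assumes "q \<in> paths" and "0 \<le> c"
  shows "(\<lambda>v. c * q v) \<in> paths"
  using assms by (auto simp: paths_def mono_on_def intro!: mult_left_mono continuous_intros)

lemma paths_Linf_cmult:
  assumes q: "q \<in> paths_Linf" and "0 \<le> c"
  shows "(\<lambda>v. c * q v) \<in> paths_Linf"
proof -
  obtain C where C: "\<And>v. v \<in> {0..<1} \<Longrightarrow> \<bar>q v\<bar> \<le> C"
    using paths_Linf_bounded[OF q] by blast
  have "AE v\<in>{0..<1} in lborel. \<bar>c * q v\<bar> \<le> c * C"
    using C \<open>0 \<le> c\<close> by (auto simp: abs_mult intro!: mult_left_mono)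
  then show ?thesis
    using assms paths_cmult[of q c] by (auto simp: paths_Linf_def)
qed

lemma zero_in_paths_Linf: "(\<lambda>v. 0) \<in> paths_Linf"
  by (auto simp: paths_Linf_def paths_def mono_on_def)

lemma paths_Linf_subset_L2: "paths_Linf \<subseteq> paths_Lp 2"
proof
  fix q assume q: "q \<in> paths_Linf"
  then have q': "q \<in> paths" by (simp add: paths_Linf_def)
  obtain C where C: "\<And>v. v \<in> {0..<1} \<Longrightarrow> \<bar>q v\<bar> \<le> C"
    using paths_Linf_bounded[OF q] by blast
  note [measurable] = paths_measurable[OF q']
  have "integrable unit_lborel (\<lambda>v. \<bar>q v\<bar> ^ 2)"
  proof (rule finite_measure.integrable_const_bound[OF finite_measure_unit_lborel])
    show "AE v in unit_lborel. norm (\<bar>q v\<bar> ^ 2) \<le> C ^ 2"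
    proof (rule AE_I2)
      fix v assume "v \<in> space unit_lborel"
      then have "\<bar>q v\<bar> ^ 2 \<le> C ^ 2"
        using C by (intro power_mono) (auto simp: space_restrict_space)
      then show "norm (\<bar>q v\<bar> ^ 2) \<le> C ^ 2" by simp
    qed
  qed measurable
  then show "q \<in> paths_Lp 2"
    using q' by (simp add: paths_Lp_def set_integrable_unit_iff)
qed

lemma set_integrable_L2_mult_Linf:
  assumes q: "q \<in> paths_Lp 2" and a: "a \<in> paths_Linf"
  shows "set_integrable lborel {0..<1} (\<lambda>v. q v * a v)"
proof -
  obtain C where C: "\<And>v. v \<in> {0..<1} \<Longrightarrow> \<bar>a v\<bar> \<le> C"
    using paths_Linf_bounded[OF a] by blast
  have C0: "0 \<le> C" using C[of 0] by force
  have q': "q \<in> paths" and a': "a \<in> paths"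
    using q a by (auto simp: paths_Lp_def paths_Linf_def)
  note [measurable] = paths_measurable[OF q'] paths_measurable[OF a']
  interpret finite_measure unit_lborel by (rule finite_measure_unit_lborel)
  have "integrable unit_lborel (\<lambda>v. \<bar>q v\<bar> ^ 2)"
    using q by (simp add: paths_Lp_def set_integrable_unit_iff)
  then have "integrable unit_lborel (\<lambda>v. (1 + \<bar>q v\<bar> ^ 2) * C)" by simp
  then have "integrable unit_lborel (\<lambda>v. q v * a v)"
  proof (rule Bochner_Integration.integrable_bound)
    show "AE v in unit_lborel. norm (q v * a v) \<le> norm ((1 + \<bar>q v\<bar> ^ 2) * C)"
    proof (rule AE_I2)
      fix v assume "v \<in> space unit_lborel"
      then have v: "\<bar>a v\<bar> \<le> C" using C by (simp add: space_restrict_space)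
      have "0 \<le> (1 - \<bar>q v\<bar>) ^ 2" by simp
      then have "2 * \<bar>q v\<bar> \<le> 1 + \<bar>q v\<bar> ^ 2"
        by (simp add: power2_diff del: zero_le_power2)
      then have "\<bar>q v\<bar> \<le> 1 + \<bar>q v\<bar> ^ 2" by linarith
      then have "\<bar>q v\<bar> * \<bar>a v\<bar> \<le> (1 + \<bar>q v\<bar> ^ 2) * C"
        using v by (intro mult_mono) auto
      then show "norm (q v * a v) \<le> norm ((1 + \<bar>q v\<bar> ^ 2) * C)"
        using C0 by (simp add: abs_mult)
    qed
  qed measurable
  then show ?thesis by (simp add: set_integrable_unit_iff)
qed

text \<open>On a box \<open>[-C, C]\<^sup>S\<close> the terms of the series are dominated by their absolute values at the corner
  \<open>(C, \<dots>, C)\<close>, so the series converges uniformly there.\<close>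

lemma abs_convergent_power_series_continuous:
  fixes \<xi> :: "real ^ 's::finite \<Rightarrow> real"
  assumes "abs_convergent_power_series \<xi>"
  shows "continuous_on {x. \<forall>s. \<bar>x $ s\<bar> \<le> C} \<xi>"
proof -
  obtain c :: "('s \<Rightarrow> nat) \<Rightarrow> real" where
    c: "\<And>x. (\<lambda>k. \<bar>c k * (\<Prod>s\<in>UNIV. (x $ s) ^ k s)\<bar>) summable_on UNIV"
       "\<And>x. \<xi> x = (\<Sum>\<^sub>\<infinity>k. c k * (\<Prod>s\<in>UNIV. (x $ s) ^ k s))"
    using assms unfolding abs_convergent_power_series_def by blast
  let ?B = "{x :: real ^ 's. \<forall>s. \<bar>x $ s\<bar> \<le> C}"
  have "uniform_limit ?B (\<lambda>K x. \<Sum>k\<in>K. c k * (\<Prod>s\<in>UNIV. (x $ s) ^ k s))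
          (\<lambda>x. \<Sum>\<^sub>\<infinity>k. c k * (\<Prod>s\<in>UNIV. (x $ s) ^ k s)) (finite_subsets_at_top UNIV)"
  proof (rule Weierstrass_m_test_general)
    show "(\<lambda>k. \<bar>c k * (\<Prod>s\<in>UNIV. ((\<chi> s. C) $ s :: real) ^ k s)\<bar>) summable_on UNIV"
      by (rule c(1))
  next
    fix k and x :: "real ^ 's" assume "x \<in> ?B"
    then have "\<bar>x $ s\<bar> \<le> C" for s by simp
    then have x: "\<bar>x $ s\<bar> \<le> \<bar>C\<bar>" for s by (rule order_trans) simp
    have "(\<Prod>s\<in>UNIV. \<bar>x $ s\<bar> ^ k s) \<le> (\<Prod>s\<in>UNIV. \<bar>C\<bar> ^ k s)"
      using x by (intro prod_mono) (auto intro: power_mono)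
    then show "norm (c k * (\<Prod>s\<in>UNIV. (x $ s) ^ k s))
                 \<le> \<bar>c k * (\<Prod>s\<in>UNIV. ((\<chi> s. C) $ s :: real) ^ k s)\<bar>"
      by (auto simp: abs_mult abs_prod power_abs intro!: mult_left_mono)
  qed
  then have "continuous_on ?B (\<lambda>x. \<Sum>\<^sub>\<infinity>k. c k * (\<Prod>s\<in>UNIV. (x $ s) ^ k s))"
    by (rule uniform_limit_theorem[rotated]) (auto intro!: always_eventually continuous_intros)
  then show ?thesis by (simp add: c(2)[abs_def])
qed

lemma set_integrable_power_series_path:
  fixes \<xi> :: "real ^ 's::finite \<Rightarrow> real"
  assumes \<xi>: "abs_convergent_power_series \<xi>" and p: "\<And>s. p s \<in> paths_Linf"
  shows "set_integrable lborel {0..<1} (\<lambda>v. \<xi> (\<chi> s. p s v))"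
proof -
  have "\<exists>C. \<forall>v\<in>{0..<1}. \<bar>p s v\<bar> \<le> C" for s
    using paths_Linf_bounded[OF p] by metis
  then obtain C where C: "\<And>s v. v \<in> {0..<1} \<Longrightarrow> \<bar>p s v\<bar> \<le> C s" by metis
  define D where "D = Max (range C)"
  have D: "\<bar>p s v\<bar> \<le> D" if "v \<in> {0..<1}" for s v
    using C[OF that, of s] unfolding D_def by (intro order_trans[OF _ Max_ge]) auto
  define B where "B = {x :: real ^ 's. \<forall>s. \<bar>x $ s\<bar> \<le> D}"
  have B_cbox: "B = cbox (\<chi> s. -D) (\<chi> s. D)"
    by (auto simp: B_def mem_box_cart abs_le_iff minus_le_iff)
  have cont: "continuous_on B \<xi>"
    unfolding B_def by (rule abs_convergent_power_series_continuous[OF \<xi>])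
  have B: "(\<chi> s. p s v) \<in> B" if "v \<in> {0..<1}" for v
    using D[OF that] by (simp add: B_def)
  have "compact (\<xi> ` B)"
    using cont by (rule compact_continuous_image) (simp add: B_cbox)
  then obtain K where K: "\<And>x. x \<in> B \<Longrightarrow> norm (\<xi> x) \<le> K"
    using compact_imp_bounded bounded_iff by (metis imageI)
  have p': "p s \<in> paths" for s using p by (simp add: paths_Linf_def)
  note [measurable] = paths_measurable[OF p']
  have "(\<lambda>v. \<chi> s. p s v) \<in> borel_measurable unit_lborel"
    by (subst borel_measurable_euclidean_space) (auto simp: Basis_vec_def inner_axis)
  then have "(\<lambda>v. \<chi> s. p s v) \<in> unit_lborel \<rightarrow>\<^sub>M restrict_space borel B"
    using B by (intro measurable_restrict_space2) (auto simp: space_restrict_space)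
  then have meas: "(\<lambda>v. \<xi> (\<chi> s. p s v)) \<in> borel_measurable unit_lborel"
    by (rule measurable_compose) (rule borel_measurable_continuous_on_restrict[OF cont])
  have "integrable unit_lborel (\<lambda>v. \<xi> (\<chi> s. p s v))"
  proof (rule finite_measure.integrable_const_bound[OF finite_measure_unit_lborel _ meas])
    show "AE v in unit_lborel. norm (\<xi> (\<chi> s. p s v)) \<le> K"
      using B K by (auto intro!: AE_I2 simp: space_restrict_space)
  qed
  then show ?thesis by (simp add: set_integrable_unit_iff)
qed


section \<open>Weighted sums and infima in the extended reals\<close>

lemma tendsto_sum_ereal_no_PInfty:
  fixes x :: "'i \<Rightarrow> nat \<Rightarrow> ereal"
  assumes "finite S" and "\<And>i. i \<in> S \<Longrightarrow> x i \<longlonglongrightarrow> l i" and "\<And>i. i \<in> S \<Longrightarrow> l i \<noteq> \<infinity>"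
  shows "(\<lambda>n. \<Sum>i\<in>S. x i n) \<longlonglongrightarrow> (\<Sum>i\<in>S. l i)"
  using assms
proof (induction S rule: finite_induct)
  case empty
  then show ?case by simp
next
  case (insert i S)
  have "(\<Sum>j\<in>S. l j) \<noteq> \<infinity>" using insert.prems(2) by (simp add: sum_Pinfty)
  moreover have "l i \<noteq> \<infinity>" using insert.prems(2) by simp
  ultimately have "(\<lambda>n. x i n + (\<Sum>j\<in>S. x j n)) \<longlonglongrightarrow> l i + (\<Sum>j\<in>S. l j)"
    using insert by (intro tendsto_add_ereal_general) auto
  then show ?case using insert.hyps by simp
qed

text \<open>Choosing minimizing sequences coordinate by coordinate is legitimate because the coordinates of
  \<open>y\<close> vary independently; the infima may be \<open>-\<infinity>\<close> but not \<open>\<infinity>\<close>, so the limit of the sum is the sum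
  of the limits.\<close>

lemma INF_weighted_sum_le:
  fixes g :: "'s::finite \<Rightarrow> 'a \<Rightarrow> real"
  assumes c: "\<And>s. 0 < c s" and A: "A \<noteq> {}"
  shows "(INF y\<in>UNIV \<rightarrow> A. ereal (\<Sum>s\<in>UNIV. c s * g s (y s)))
           \<le> (\<Sum>s\<in>UNIV. ereal (c s) * (INF r\<in>A. ereal (g s r)))" (is "?L \<le> _")
proof -
  have "\<exists>y. (\<forall>n. y n \<in> A) \<and> (\<lambda>n. ereal (g s (y n))) \<longlonglongrightarrow> (INF r\<in>A. ereal (g s r))" for s
  proof -
    have "(\<lambda>r. ereal (g s r)) ` A \<noteq> {}" using A by simp
    from Inf_as_limit[OF this] obtain z where
      z: "\<And>n. z n \<in> (\<lambda>r. ereal (g s r)) ` A" "z \<longlonglongrightarrow> (INF r\<in>A. ereal (g s r))" by blast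
    have "\<forall>n. \<exists>r. r \<in> A \<and> z n = ereal (g s r)" using z(1) by blast
    then obtain y where "\<And>n. y n \<in> A" "\<And>n. z n = ereal (g s (y n))" by metis
    with z(2) show ?thesis by (intro exI[of _ y]) (simp add: fun_eq_iff flip: \<open>\<And>n. z n = _\<close>)
  qed
  then obtain y where y: "\<And>s n. y s n \<in> A"
      "\<And>s. (\<lambda>n. ereal (g s (y s n))) \<longlonglongrightarrow> (INF r\<in>A. ereal (g s r))"
    by metis
  have finite: "(INF r\<in>A. ereal (g s r)) \<noteq> \<infinity>" for s
  proof -
    obtain r where "r \<in> A" using A by blast
    then have "(INF r\<in>A. ereal (g s r)) \<le> ereal (g s r)" by (rule INF_lower)
    then show ?thesis by auto
  qed
  have "(\<lambda>n. \<Sum>s\<in>UNIV. ereal (c s) * ereal (g s (y s n)))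
          \<longlonglongrightarrow> (\<Sum>s\<in>UNIV. ereal (c s) * (INF r\<in>A. ereal (g s r)))"
  proof (rule tendsto_sum_ereal_no_PInfty)
    show "(\<lambda>n. ereal (c s) * ereal (g s (y s n))) \<longlonglongrightarrow> ereal (c s) * (INF r\<in>A. ereal (g s r))" for s
      by (rule tendsto_cmult_ereal) (simp, rule y(2))
    show "ereal (c s) * (INF r\<in>A. ereal (g s r)) \<noteq> \<infinity>" for s
      using finite[of s] c[of s] by (cases "INF r\<in>A. ereal (g s r)") auto
  qed simp
  moreover have "?L \<le> (\<Sum>s\<in>UNIV. ereal (c s) * ereal (g s (y s n)))" for n
    using y(1) by (auto intro!: INF_lower2[of "\<lambda>s. y s n"])
  ultimately show ?thesis
    by (intro LIMSEQ_le_const) auto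
qed

lemma le_weighted_average:
  fixes x :: "'s::finite \<Rightarrow> real" and m :: ereal
  assumes "\<And>s. m \<le> ereal (x s)" and "\<And>s. 0 \<le> c s" and "(\<Sum>s\<in>UNIV. c s) = 1"
  shows "m \<le> ereal (\<Sum>s\<in>UNIV. c s * x s)"
proof (cases m)
  case (real b)
  have "b = (\<Sum>s\<in>UNIV. c s * b)" using assms(3) by (simp flip: sum_distrib_right)
  also have "\<dots> \<le> (\<Sum>s\<in>UNIV. c s * x s)"
    using assms real by (intro sum_mono mult_left_mono) auto
  finally show ?thesis using real by simp
qed (use assms(1) in auto)

lemma ereal_weighted_sum_const:
  fixes c :: "'s::finite \<Rightarrow> real" and y :: ereal
  assumes "\<And>s. 0 \<le> c s" and "(\<Sum>s\<in>UNIV. c s) = 1"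
  shows "(\<Sum>s\<in>UNIV. ereal (c s) * y) = y"
proof -
  have "(\<Sum>s\<in>UNIV. ereal (c s) * y) = (\<Sum>s\<in>UNIV. ereal (c s)) * y"
    using assms(1) by (intro sum_ereal_left_distrib[symmetric]) simp
  also have "(\<Sum>s\<in>UNIV. ereal (c s)) = 1" by (simp add: assms(2) one_ereal_def)
  finally show ?thesis by simp
qed


section \<open>Comparison of the functionals\<close>

text \<open>The quantities inside the two \<open>sup inf\<close> formulas, with \<open>\<psi>\<^sub>\<circ>\<close> abstracted to a function \<open>\<psi>\<close> of a
  path.\<close>

definition one_functional ::
    "((real \<Rightarrow> real) \<Rightarrow> real) \<Rightarrow> (real \<Rightarrow> real) \<Rightarrow> real \<Rightarrow> (real \<Rightarrow> real) \<Rightarrow>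
     (real \<Rightarrow> real) \<Rightarrow> (real \<Rightarrow> real) \<Rightarrow> real" where
  "one_functional \<psi> \<xi>\<^sub>1 t r a r' =
     \<psi> r' + inner_L2 (\<lambda>v. r v - r' v) a + t * (LINT v:{0..<1}|lborel. \<xi>\<^sub>1 (a v))"

definition multi_functional ::
    "((real \<Rightarrow> real) \<Rightarrow> real) \<Rightarrow> real ^ 's::finite \<Rightarrow> (real ^ 's \<Rightarrow> real) \<Rightarrow> real \<Rightarrow>
     ('s \<Rightarrow> real \<Rightarrow> real) \<Rightarrow> ('s \<Rightarrow> real \<Rightarrow> real) \<Rightarrow> ('s \<Rightarrow> real \<Rightarrow> real) \<Rightarrow> real" where
  "multi_functional \<psi> lam \<xi> t q p q' =
     (\<Sum>s\<in>UNIV. lam $ s * \<psi> (q' s)) + (\<Sum>s\<in>UNIV. inner_L2 (\<lambda>v. q s v - q' s v) (p s))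
     + t * (LINT v:{0..<1}|lborel. \<xi> (\<chi> s. p s v))"

lemma inner_L2_cmult_right: "inner_L2 g (\<lambda>v. c * h v) = c * inner_L2 g h"
proof -
  have "(\<lambda>v. g v * (c * h v)) = (\<lambda>v. c * (g v * h v))" by (simp add: mult_ac)
  then show ?thesis by (simp add: inner_L2_def)
qed

lemma inner_L2_diff_left:
  assumes "g \<in> paths_Lp 2" "h \<in> paths_Lp 2" "a \<in> paths_Linf"
  shows "inner_L2 (\<lambda>v. g v - h v) a = inner_L2 g a - inner_L2 h a"
  unfolding inner_L2_def left_diff_distrib
  by (rule set_integral_diff(2)) (use assms in \<open>auto intro: set_integrable_L2_mult_Linf\<close>)

text \<open>The measurability and integrability of \<open>\<xi>\<^sub>1 \<circ> a\<close> come from \<open>\<xi>\<close>: on the nonnegative reals, \<open>\<xi>\<^sub>1\<close> is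
  the restriction of \<open>\<xi>\<close> to the ray through \<open>\<lambda>\<close>.\<close>

lemma balanced_one_species_on_path:
  assumes "balanced \<xi> lam \<xi>\<^sub>1" and "a \<in> paths_Linf" and "v \<in> {0..<1}"
  shows "\<xi>\<^sub>1 (a v) = \<xi> (\<chi> s. lam $ s * a v)"
proof -
  have "0 \<le> a v" using assms by (auto simp: paths_Linf_def paths_def)
  moreover have "(\<chi> s. lam $ s * a v) = a v *\<^sub>R lam" by (simp add: vec_eq_iff)
  ultimately show ?thesis using assms(1) by (simp add: balanced_def)
qed

lemma set_integrable_one_species_path:
  assumes "abs_convergent_power_series \<xi>" "balanced \<xi> lam \<xi>\<^sub>1" "\<And>s. 0 < lam $ s" "a \<in> paths_Linf"
  shows "set_integrable lborel {0..<1} (\<lambda>v. \<xi>\<^sub>1 (a v))"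
proof -
  have "set_integrable lborel {0..<1} (\<lambda>v. \<xi> (\<chi> s. lam $ s * a v))"
    using assms by (intro set_integrable_power_series_path paths_Linf_cmult less_imp_le)
  then show ?thesis
    by (subst set_integrable_cong[OF refl refl balanced_one_species_on_path[OF assms(2,4)]])
qed

text \<open>Rescaling \<open>p\<^sub>s\<close> to \<open>p\<^sub>s / \<lambda>\<^sub>s\<close> turns the inner products into a \<open>\<lambda>\<close>-average and is the rescaling under
  which the balance condition bounds \<open>\<xi>(p)\<close> by an average.\<close>

lemma multi_functional_le_average:
  fixes lam :: "real ^ 's::finite"
  assumes \<xi>: "abs_convergent_power_series \<xi>" and bal: "balanced \<xi> lam \<xi>\<^sub>1"
    and lam: "\<And>s. 0 < lam $ s" and t: "0 \<le> t" and p: "\<And>s. p s \<in> paths_Linf"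
  shows "multi_functional \<psi> lam \<xi> t q p q'
           \<le> (\<Sum>s\<in>UNIV. lam $ s * one_functional \<psi> \<xi>\<^sub>1 t (q s) (\<lambda>v. 1 / lam $ s * p s v) (q' s))"
proof -
  define a where "a s v = 1 / lam $ s * p s v" for s v
  have a: "a s \<in> paths_Linf" for s
    unfolding a_def[abs_def] using lam[of s] p by (intro paths_Linf_cmult) auto
  have inner: "inner_L2 g (p s) = lam $ s * inner_L2 g (a s)" for g s
    unfolding a_def[abs_def] inner_L2_cmult_right using lam[of s] by simp
  have int: "set_integrable lborel {0..<1} (\<lambda>v. lam $ s * \<xi>\<^sub>1 (a s v))" for s
    using set_integrable_one_species_path[OF \<xi> bal lam a] by simp
  have int_sum: "set_integrable lborel {0..<1} (\<lambda>v. \<Sum>s\<in>UNIV. lam $ s * \<xi>\<^sub>1 (a s v))"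
    using int by (simp add: set_integrable_unit_iff)
  have "(LINT v:{0..<1}|lborel. \<xi> (\<chi> s. p s v))
          \<le> (LINT v:{0..<1}|lborel. \<Sum>s\<in>UNIV. lam $ s * \<xi>\<^sub>1 (a s v))"
  proof (rule set_integral_mono[OF set_integrable_power_series_path[OF \<xi> p] int_sum])
    fix v :: real assume "v \<in> {0..<1}"
    then have "0 \<le> p s v" for s using p[of s] by (auto simp: paths_Linf_def paths_def)
    then show "\<xi> (\<chi> s. p s v) \<le> (\<Sum>s\<in>UNIV. lam $ s * \<xi>\<^sub>1 (a s v))"
      using bal[unfolded balanced_def, THEN conjunct2, rule_format, of "\<chi> s. p s v"]
      by (simp add: a_def)
  qed
  also have "\<dots> = (\<Sum>s\<in>UNIV. lam $ s * (LINT v:{0..<1}|lborel. \<xi>\<^sub>1 (a s v)))"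
  proof -
    have "(LINT v:{0..<1}|lborel. \<Sum>s\<in>UNIV. lam $ s * \<xi>\<^sub>1 (a s v))
            = (\<Sum>s\<in>UNIV. LINT v:{0..<1}|lborel. lam $ s * \<xi>\<^sub>1 (a s v))"
      using int unfolding set_lebesgue_integral_def set_integrable_def scaleR_sum_right
      by (intro Bochner_Integration.integral_sum) auto
    then show ?thesis by simp
  qed
  finally have "t * (LINT v:{0..<1}|lborel. \<xi> (\<chi> s. p s v))
      \<le> t * (\<Sum>s\<in>UNIV. lam $ s * (LINT v:{0..<1}|lborel. \<xi>\<^sub>1 (a s v)))"
    using t by (rule mult_left_mono)
  then show ?thesis
    unfolding multi_functional_def one_functional_def a_def[symmetric]
    by (simp add: inner distrib_left sum.distrib sum_distrib_left mult.left_commute)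
qed

text \<open>Along \<open>p = a \<lambda>\<close>, only the average of the paths \<open>q\<^sub>s\<close> matters, since the inner products of the \<open>q\<^sub>s\<close>
  are all taken with the same \<open>a\<close>.\<close>

lemma multi_functional_on_ray:
  fixes lam :: "real ^ 's::finite"
  assumes bal: "balanced \<xi> lam \<xi>\<^sub>1" and lam1: "(\<Sum>s\<in>UNIV. lam $ s) = 1"
    and q: "\<And>s. q s \<in> paths_Lp 2" and q': "\<And>s. q' s \<in> paths_Linf" and a: "a \<in> paths_Linf"
  shows "multi_functional \<psi> lam \<xi> t q (\<lambda>s v. lam $ s * a v) q'
           = (\<Sum>s\<in>UNIV. lam $ s * one_functional \<psi> \<xi>\<^sub>1 t (\<lambda>v. \<Sum>s\<in>UNIV. lam $ s * q s v) a (q' s))"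
proof -
  let ?qm = "\<lambda>v. \<Sum>s\<in>UNIV. lam $ s * q s v"
  have int_q: "set_integrable lborel {0..<1} (\<lambda>v. q s v * a v)" for s
    using q a by (rule set_integrable_L2_mult_Linf)
  have q'2: "q' s \<in> paths_Lp 2" for s using q' paths_Linf_subset_L2 by blast
  have qm_a: "?qm v * a v = (\<Sum>s\<in>UNIV. lam $ s * (q s v * a v))" for v
    by (simp add: sum_distrib_right mult.assoc)
  have int_qm: "set_integrable lborel {0..<1} (\<lambda>v. ?qm v * a v)"
    using int_q unfolding qm_a by (simp add: set_integrable_unit_iff)
  have inner_qm: "inner_L2 ?qm a = (\<Sum>s\<in>UNIV. lam $ s * inner_L2 (q s) a)"
  proof -
    have "inner_L2 ?qm a = (\<Sum>s\<in>UNIV. LINT v:{0..<1}|lborel. lam $ s * (q s v * a v))"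
      using int_q unfolding inner_L2_def qm_a set_lebesgue_integral_def set_integrable_def
        scaleR_sum_right
      by (intro Bochner_Integration.integral_sum) (simp add: mult.left_commute)
    then show ?thesis by (simp add: inner_L2_def)
  qed
  have inner_diff: "inner_L2 (\<lambda>v. ?qm v - q' s v) a = inner_L2 ?qm a - inner_L2 (q' s) a" for s
    unfolding inner_L2_def left_diff_distrib
    by (rule set_integral_diff(2)[OF int_qm set_integrable_L2_mult_Linf[OF q'2 a]])
  have "(LINT v:{0..<1}|lborel. \<xi> (\<chi> s. lam $ s * a v)) = (LINT v:{0..<1}|lborel. \<xi>\<^sub>1 (a v))"
    using balanced_one_species_on_path[OF bal a] by (intro set_lebesgue_integral_cong) auto
  moreover have "(\<Sum>s\<in>UNIV. lam $ s * x) = x" for x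
    using lam1 by (simp flip: sum_distrib_right)
  ultimately show ?thesis
    unfolding multi_functional_def one_functional_def
    by (simp add: inner_L2_cmult_right inner_diff inner_L2_diff_left[OF q q'2 a] inner_qm
        distrib_left right_diff_distrib sum.distrib sum_subtractf)
qed


section \<open>Bounds on the limit free energy\<close>

lemma multi_species_formula_eq:
  "multi_species_formula P R G w lam \<xi> t q =
     (SUP p\<in>UNIV \<rightarrow> paths_Linf. INF q'\<in>UNIV \<rightarrow> paths_Linf.
        ereal (multi_functional (\<psi>_circ P R G w) lam \<xi> t q p q'))"
  by (simp add: multi_species_formula_def multi_functional_def \<psi>_multi_def)

lemma one_species_formula_eq:
  "one_species_formula P R G w \<xi>\<^sub>1 t r =
     (SUP a\<in>paths_Linf. INF r'\<in>paths_Linf. ereal (one_functional (\<psi>_circ P R G w) \<xi>\<^sub>1 t r a r'))"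
  by (simp add: one_species_formula_def one_functional_def)

lemma multi_species_formula_le:
  fixes lam :: "real ^ 's::finite"
  assumes \<xi>: "abs_convergent_power_series \<xi>" and bal: "balanced \<xi> lam \<xi>\<^sub>1"
    and lam: "\<And>s. 0 < lam $ s" and t: "0 \<le> t"
  shows "multi_species_formula P R G w lam \<xi> t q
           \<le> (\<Sum>s\<in>UNIV. ereal (lam $ s) * one_species_formula P R G w \<xi>\<^sub>1 t (q s))"
  unfolding multi_species_formula_eq
proof (rule SUP_least)
  fix p :: "'s \<Rightarrow> real \<Rightarrow> real" assume "p \<in> UNIV \<rightarrow> paths_Linf"
  then have p: "p s \<in> paths_Linf" for s by auto
  let ?\<psi> = "\<psi>_circ P R G w"
  let ?a = "\<lambda>s v. 1 / lam $ s * p s v"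
  have a: "?a s \<in> paths_Linf" for s
    using lam[of s] p by (intro paths_Linf_cmult) auto
  have "(INF q'\<in>UNIV \<rightarrow> paths_Linf. ereal (multi_functional ?\<psi> lam \<xi> t q p q'))
      \<le> (INF q'\<in>UNIV \<rightarrow> paths_Linf.
           ereal (\<Sum>s\<in>UNIV. lam $ s * one_functional ?\<psi> \<xi>\<^sub>1 t (q s) (?a s) (q' s)))"
    by (rule INF_mono') (simp only: ereal_less_eq, rule multi_functional_le_average[OF \<xi> bal lam t p])
  also have "\<dots> \<le> (\<Sum>s\<in>UNIV. ereal (lam $ s) *
                      (INF r'\<in>paths_Linf. ereal (one_functional ?\<psi> \<xi>\<^sub>1 t (q s) (?a s) r')))"
    using lam zero_in_paths_Linf by (intro INF_weighted_sum_le) auto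
  also have "\<dots> \<le> (\<Sum>s\<in>UNIV. ereal (lam $ s) * one_species_formula P R G w \<xi>\<^sub>1 t (q s))"
    unfolding one_species_formula_eq
    using lam a by (intro sum_mono ereal_mult_left_mono SUP_upper) (auto intro: less_imp_le)
  finally show "(INF q'\<in>UNIV \<rightarrow> paths_Linf. ereal (multi_functional ?\<psi> lam \<xi> t q p q'))
      \<le> (\<Sum>s\<in>UNIV. ereal (lam $ s) * one_species_formula P R G w \<xi>\<^sub>1 t (q s))" .
qed

lemma multi_species_formula_ge:
  fixes lam :: "real ^ 's::finite"
  assumes bal: "balanced \<xi> lam \<xi>\<^sub>1" and lam: "\<And>s. 0 < lam $ s"
    and lam1: "(\<Sum>s\<in>UNIV. lam $ s) = 1" and q: "\<And>s. q s \<in> paths_Lp 2"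
  shows "one_species_formula P R G w \<xi>\<^sub>1 t (\<lambda>v. \<Sum>s\<in>UNIV. lam $ s * q s v)
           \<le> multi_species_formula P R G w lam \<xi> t q"
  unfolding one_species_formula_eq multi_species_formula_eq
proof (rule SUP_mono)
  fix a assume a: "a \<in> paths_Linf"
  let ?\<psi> = "\<psi>_circ P R G w" and ?p = "\<lambda>s v. lam $ s * a v"
    and ?qm = "\<lambda>v. \<Sum>s\<in>UNIV. lam $ s * q s v"
  have "(INF r'\<in>paths_Linf. ereal (one_functional ?\<psi> \<xi>\<^sub>1 t ?qm a r'))
          \<le> (INF q'\<in>UNIV \<rightarrow> paths_Linf. ereal (multi_functional ?\<psi> lam \<xi> t q ?p q'))"
  proof (rule INF_greatest)
    fix q' :: "'s \<Rightarrow> real \<Rightarrow> real" assume "q' \<in> UNIV \<rightarrow> paths_Linf"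
    then have q': "q' s \<in> paths_Linf" for s by auto
    show "(INF r'\<in>paths_Linf. ereal (one_functional ?\<psi> \<xi>\<^sub>1 t ?qm a r'))
            \<le> ereal (multi_functional ?\<psi> lam \<xi> t q ?p q')"
      unfolding multi_functional_on_ray[OF bal lam1 q q' a]
      using lam lam1 q' by (intro le_weighted_average INF_lower) (auto intro: less_imp_le)
  qed
  moreover have "?p \<in> UNIV \<rightarrow> paths_Linf"
    using a lam by (auto intro!: paths_Linf_cmult intro: less_imp_le)
  ultimately show "\<exists>p\<in>UNIV \<rightarrow> paths_Linf.
      (INF r'\<in>paths_Linf. ereal (one_functional ?\<psi> \<xi>\<^sub>1 t ?qm a r'))
        \<le> (INF q'\<in>UNIV \<rightarrow> paths_Linf. ereal (multi_functional ?\<psi> lam \<xi> t q p q'))"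
    by blast
qed

lemma (in multi_species_model) lam_sum: "(\<Sum>s\<in>UNIV. lam $ s) = 1"
proof (rule LIMSEQ_unique)
  show "(\<lambda>N. \<Sum>s\<in>UNIV. species_fraction I N $ s) \<longlonglongrightarrow> (\<Sum>s\<in>UNIV. lam $ s)"
    by (intro tendsto_sum tendsto_vec_nth species_limit)
  have "(\<Sum>s\<in>UNIV. species_fraction I N $ s) = 1" if N: "N \<ge> 1" for N
  proof -
    have "I N s \<subseteq> {1..N}" for s using species_cover[OF N] by blast
    then have "finite (I N s)" for s by (rule finite_subset) simp
    then have "card (\<Union>s. I N s) = (\<Sum>s\<in>UNIV. card (I N s))"
      using species_disjoint[OF N] by (intro card_UN_disjoint') auto
    then have "(\<Sum>s\<in>UNIV. real (card (I N s))) = real N"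
      unfolding species_cover[OF N] by (simp flip: of_nat_sum)
    then show ?thesis
      using N by (simp add: species_fraction_def flip: sum_divide_distrib)
  qed
  then have "eventually (\<lambda>N. (\<Sum>s\<in>UNIV. species_fraction I N $ s) = 1) sequentially"
    by (auto simp: eventually_sequentially)
  then show "(\<lambda>N. \<Sum>s\<in>UNIV. species_fraction I N $ s) \<longlonglongrightarrow> 1"
    by (rule tendsto_eventually)
qed

theorem proposition9p3:
  fixes P :: "'o measure"
    and R :: "'o \<Rightarrow> 'h::{real_inner, complete_space, second_countable_topology} measure"
    and G :: "'w measure"
    and w :: "nat \<Rightarrow> (real \<Rightarrow> real) \<Rightarrow> 'o \<Rightarrow> 'h \<Rightarrow> 'w \<Rightarrow> real"
    and I :: "nat \<Rightarrow> 's::finite \<Rightarrow> nat set"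
    and lam :: "real ^ 's"
    and \<xi> :: "real ^ 's \<Rightarrow> real"
    and H :: "nat \<Rightarrow> (nat \<Rightarrow> real) \<Rightarrow> 'w \<Rightarrow> real"
    and \<xi>\<^sub>1 :: "real \<Rightarrow> real"
    and u :: "real \<Rightarrow> (real \<Rightarrow> real) \<Rightarrow> ereal"
    and f :: "real \<Rightarrow> ('s \<Rightarrow> real \<Rightarrow> real) \<Rightarrow> ereal"
    and F :: "nat \<Rightarrow> real \<Rightarrow> ('s \<Rightarrow> real \<Rightarrow> real) \<Rightarrow> real"
  assumes model: "multi_species_model P R G w I lam \<xi> H"
    and balanced: "balanced \<xi> lam \<xi>\<^sub>1"
    and u: "u = one_species_formula P R G w \<xi>\<^sub>1"
    and f: "f = multi_species_formula P R G w lam \<xi>"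
    and F: "F = free_energy P R G w I \<xi> H"
  shows "(\<forall>t\<ge>0. \<forall>q \<in> UNIV \<rightarrow> paths_Lp 2.
            u t (\<lambda>v. \<Sum>s\<in>UNIV. lam $ s * q s v) \<le> f t q \<and>
            f t q \<le> (\<Sum>s\<in>UNIV. ereal (lam $ s) * u t (q s))) \<and>
         (\<forall>t\<ge>0. f t (\<lambda>s v. 0) = u t (\<lambda>v. 0)) \<and>
         ((\<forall>t\<ge>0. \<forall>q \<in> UNIV \<rightarrow> paths_Lp 2. (\<lambda>N. ereal (F N t q)) \<longlonglongrightarrow> f t q) \<longrightarrow>
            (\<forall>t\<ge>0. \<forall>q \<in> UNIV \<rightarrow> paths_Lp 2.
               u t (\<lambda>v. \<Sum>s\<in>UNIV. lam $ s * q s v) \<le> lim (\<lambda>N. ereal (F N t q)) \<and>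
               lim (\<lambda>N. ereal (F N t q)) \<le> (\<Sum>s\<in>UNIV. ereal (lam $ s) * u t (q s))) \<and>
            (\<forall>t\<ge>0. lim (\<lambda>N. ereal (F N t (\<lambda>s v. 0))) = u t (\<lambda>v. 0)))"
proof -
  interpret multi_species_model P R G w I lam \<xi> H by (rule model)
  have lam: "0 < lam $ s" for s using lam_range[of s] by simp
  have lower: "u t (\<lambda>v. \<Sum>s\<in>UNIV. lam $ s * q s v) \<le> f t q"
    if "q \<in> UNIV \<rightarrow> paths_Lp 2" for t q
    unfolding u f using that by (intro multi_species_formula_ge balanced lam lam_sum) auto
  have upper: "f t q \<le> (\<Sum>s\<in>UNIV. ereal (lam $ s) * u t (q s))" if "0 \<le> t" for t q
    unfolding u f using that by (intro multi_species_formula_le \<xi>_power_series balanced lam)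
  have zero: "(\<lambda>s v. 0) \<in> (UNIV :: 's set) \<rightarrow> paths_Lp 2"
    using zero_in_paths_Linf paths_Linf_subset_L2 by auto
  have at_zero: "f t (\<lambda>s v. 0) = u t (\<lambda>v. 0)" if "0 \<le> t" for t
  proof (rule antisym)
    show "f t (\<lambda>s v. 0) \<le> u t (\<lambda>v. 0)"
      using upper[OF that, of "\<lambda>s v. 0"] ereal_weighted_sum_const[of "($) lam"] lam lam_sum
      by (simp add: less_imp_le)
    show "u t (\<lambda>v. 0) \<le> f t (\<lambda>s v. 0)" using lower[OF zero, of t] by simp
  qed
  show ?thesis
  proof (intro conjI impI)
    assume "\<forall>t\<ge>0. \<forall>q \<in> UNIV \<rightarrow> paths_Lp 2. (\<lambda>N. ereal (F N t q)) \<longlonglongrightarrow> f t q"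
    then have lim: "lim (\<lambda>N. ereal (F N t q)) = f t q"
      if "0 \<le> t" "q \<in> UNIV \<rightarrow> paths_Lp 2" for t q
      using that by (auto intro: limI)
    show "\<forall>t\<ge>0. \<forall>q \<in> UNIV \<rightarrow> paths_Lp 2.
            u t (\<lambda>v. \<Sum>s\<in>UNIV. lam $ s * q s v) \<le> lim (\<lambda>N. ereal (F N t q)) \<and>
            lim (\<lambda>N. ereal (F N t q)) \<le> (\<Sum>s\<in>UNIV. ereal (lam $ s) * u t (q s))"
      using lower upper by (auto simp: lim)
    show "\<forall>t\<ge>0. lim (\<lambda>N. ereal (F N t (\<lambda>s v. 0))) = u t (\<lambda>v. 0)"
      using at_zero zero by (simp add: lim)
  qed (use lower upper at_zero in auto)
qed

end
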